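(* Let $V$ be a finite-dimensional complex vector space equipped with a nondegenerate symmetric bilinear form $(\cdot|\cdot)$. The only quadratic equations vanishing on $Y(V)$ are Robeva's equations; that is, every homogeneous quadratic polynomial on $S^3V$ that vanishes identically on $Y(V)$ is a linear combination of Robeva's equations.
   Context: $S^3V\subseteq V^{\otimes 3}$ is the space of symmetric tensors. Identify $V$ with $V^*$ via $v\mapsto (v|\cdot)$. A tensor $T=\sum_i a_i\otimes b_i\otimes c_i\in S^3V$ defines the commutative multiplication $\mu_T(x,y)=\sum_i (a_i|x)(b_i|y)c_i$ on $V$. Robeva's equations are the quadratic equations in $T\in S^3V$ expressing associativity of $\mu_T$, i.e. for all $x,y,z,w\in V$ the quadratic polynomial $$T\mapsto (\mu_T(x,\mu_T(y,z))\,|\,w)-(\mu_T(\mu_T(x,y),z)\,|\,w),$$ equivalently $T\mapsto (\mu_T(y,z)|\mu_T(x,w))-(\mu_T(x,y)|\mu_T(z,w))$. A tensor $T\in S^3V$ is strongly odeco if $T=\sum_{i=1}^k v_i^{\otimes 3}$ for some $k\ge 0$ and nonzero, pairwise orthogonal $v_i\in V$ with $(v_i|v_i)\neq 0$ for all $i$. $Y(V)$ is the Zariski closure in $S^3V$ of the set of strongly odeco tensors. *)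

theory Defs
  imports Complex_Main "HOL-Library.Function_Algebras"
begin

section \<open>Polynomial functions on a linear subspace of a function space\<close>

definition fun_scale :: "complex \<Rightarrow> ('a \<Rightarrow> complex) \<Rightarrow> ('a \<Rightarrow> complex)" where
  "fun_scale c f = (\<lambda>x. c * f x)"

interpretation fun_space: vector_space fun_scale
  by unfold_locales (auto simp: fun_scale_def fun_eq_iff algebra_simps)

text \<open>In this section \<open>W\<close> is a linear subspace of \<open>'a \<Rightarrow> complex\<close>. Functions on \<open>W\<close> are
  represented by functions on the whole type whose values outside \<open>W\<close> are irrelevant.\<close>

definition linear_functionals :: "('a \<Rightarrow> complex) set \<Rightarrow> (('a \<Rightarrow> complex) \<Rightarrow> complex) set" where
  "linear_functionals W = {l. (\<forall>S\<in>W. \<forall>T\<in>W. l (S + T) = l S + l T) \<and>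
                              (\<forall>c. \<forall>T\<in>W. l (fun_scale c T) = c * l T)}"

text \<open>The image of the \<open>d\<close>-th symmetric power of the dual of \<open>W\<close>. As the ground field is infinite,
  polynomials on \<open>W\<close> may be identified with the functions they induce.\<close>

definition homogeneous_polys ::
    "('a \<Rightarrow> complex) set \<Rightarrow> nat \<Rightarrow> (('a \<Rightarrow> complex) \<Rightarrow> complex) set" where
  "homogeneous_polys W d =
     fun_space.span {(\<lambda>T. \<Prod>i<d. l i T) | l. \<forall>i<d. l i \<in> linear_functionals W}"

definition polys :: "('a \<Rightarrow> complex) set \<Rightarrow> (('a \<Rightarrow> complex) \<Rightarrow> complex) set" where
  "polys W = fun_space.span (\<Union>d. homogeneous_polys W d)"

definition zariski_closure :: "('a \<Rightarrow> complex) set \<Rightarrow> ('a \<Rightarrow> complex) set \<Rightarrow> ('a \<Rightarrow> complex) set" where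
  "zariski_closure W X = {T \<in> W. \<forall>p \<in> polys W. (\<forall>S\<in>X. p S = 0) \<longrightarrow> p T = 0}"


section \<open>Symmetric tensors over a space with a nondegenerate symmetric bilinear form\<close>

text \<open>The vector space is the whole type \<open>'v\<close>; linearity of \<open>form\<close> in its first argument follows
  from symmetry.\<close>

locale quadratic_space = vector_space scale
  for scale :: "complex \<Rightarrow> 'v::ab_group_add \<Rightarrow> 'v" +
  fixes form :: "'v \<Rightarrow> 'v \<Rightarrow> complex"
  assumes finite_dimensional: "\<exists>B. finite B \<and> span B = UNIV"
    and form_linear: "\<And>x. Vector_Spaces.linear scale (*) (form x)"
    and form_sym: "\<And>x y. form x y = form y x"
    and form_nondegenerate: "\<And>x. (\<And>y. form x y = 0) \<Longrightarrow> x = 0"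

text \<open>Via the identification of \<open>V\<close> with its dual, a tensor of order three is represented by
  the trilinear form that it induces on \<open>V\<close>. The universal property proved below
  shows that this is a model of the third tensor power.\<close>

definition pure_tensor ::
    "('v \<Rightarrow> 'v \<Rightarrow> complex) \<Rightarrow> 'v \<Rightarrow> 'v \<Rightarrow> 'v \<Rightarrow> ('v \<times> 'v \<times> 'v \<Rightarrow> complex)" where
  "pure_tensor form a b c = (\<lambda>(x, y, z). form a x * form b y * form c z)"

definition tensor3 :: "('v \<Rightarrow> 'v \<Rightarrow> complex) \<Rightarrow> ('v \<times> 'v \<times> 'v \<Rightarrow> complex) set" where
  "tensor3 form = {T. \<exists>(k::nat) a b c. T = (\<Sum>i<k. pure_tensor form (a i) (b i) (c i))}"

text \<open>The two transpositions generate the symmetric group on the three tensor factors.\<close>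

definition sym_tensor3 :: "('v \<Rightarrow> 'v \<Rightarrow> complex) \<Rightarrow> ('v \<times> 'v \<times> 'v \<Rightarrow> complex) set" where
  "sym_tensor3 form = {T \<in> tensor3 form.
     (\<forall>x y z. T (y, x, z) = T (x, y, z)) \<and> (\<forall>x y z. T (x, z, y) = T (x, y, z))}"

text \<open>Well defined on \<open>tensor3\<close>: see \<open>mu_sum\<close> below.\<close>

definition mu :: "(complex \<Rightarrow> 'v \<Rightarrow> 'v) \<Rightarrow> ('v \<Rightarrow> 'v \<Rightarrow> complex) \<Rightarrow>
    ('v \<times> 'v \<times> 'v \<Rightarrow> complex) \<Rightarrow> 'v \<Rightarrow> 'v \<Rightarrow> 'v::ab_group_add" where
  "mu scale form T x y = (THE m. \<exists>(k::nat) a b c.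
     T = (\<Sum>i<k. pure_tensor form (a i) (b i) (c i)) \<and>
     m = (\<Sum>i<k. scale (form (a i) x * form (b i) y) (c i)))"

definition robeva :: "(complex \<Rightarrow> 'v \<Rightarrow> 'v) \<Rightarrow> ('v \<Rightarrow> 'v \<Rightarrow> complex) \<Rightarrow>
    'v \<Rightarrow> 'v \<Rightarrow> 'v \<Rightarrow> 'v::ab_group_add \<Rightarrow> ('v \<times> 'v \<times> 'v \<Rightarrow> complex) \<Rightarrow> complex" where
  "robeva scale form x y z w T =
     form (mu scale form T x (mu scale form T y z)) w -
     form (mu scale form T (mu scale form T x y) z) w"

definition robeva_equations :: "(complex \<Rightarrow> 'v \<Rightarrow> 'v) \<Rightarrow> ('v \<Rightarrow> 'v \<Rightarrow> complex) \<Rightarrow>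
    (('v::ab_group_add \<times> 'v \<times> 'v \<Rightarrow> complex) \<Rightarrow> complex) set" where
  "robeva_equations scale form = {robeva scale form x y z w | x y z w. True}"

definition strongly_odeco ::
    "('v::ab_group_add \<Rightarrow> 'v \<Rightarrow> complex) \<Rightarrow> ('v \<times> 'v \<times> 'v \<Rightarrow> complex) \<Rightarrow> bool" where
  "strongly_odeco form T \<longleftrightarrow> (\<exists>(k::nat) v.
     (\<forall>i<k. v i \<noteq> 0 \<and> form (v i) (v i) \<noteq> 0) \<and>
     (\<forall>i<k. \<forall>j<k. i \<noteq> j \<longrightarrow> form (v i) (v j) = 0) \<and>
     T = (\<Sum>i<k. pure_tensor form (v i) (v i) (v i)))"

definition odeco_variety ::
    "('v::ab_group_add \<Rightarrow> 'v \<Rightarrow> complex) \<Rightarrow> ('v \<times> 'v \<times> 'v \<Rightarrow> complex) set" where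
  "odeco_variety form = zariski_closure (sym_tensor3 form) {T. strongly_odeco form T}"


section \<open>Sanity checks\<close>

lemma sum_fun_apply: "(\<Sum>i\<in>A. f i) x = (\<Sum>i\<in>A. f i x)" for f :: "'i \<Rightarrow> 'a \<Rightarrow> complex"
  by (induction A rule: infinite_finite_induct) auto

lemma linear_mult_iff: "Vector_Spaces.linear scale (*) f \<longleftrightarrow> vector_space scale \<and>
    (\<forall>x y. f (x + y) = f x + f y) \<and> (\<forall>c x. f (scale c x) = c * f x)"
  for scale :: "complex \<Rightarrow> 'v::ab_group_add \<Rightarrow> 'v"
proof -
  have "vector_space ((*) :: complex \<Rightarrow> _)"
    by unfold_locales (auto simp: algebra_simps)
  then show ?thesis
    by (auto simp: Vector_Spaces.linear_def module_hom_def module_hom_axioms_def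
        module_iff_vector_space)
qed

context quadratic_space
begin

lemma form_simps:
  "form x (y + z) = form x y + form x z" "form x (scale c y) = c * form x y"
  "form (y + z) x = form y x + form z x" "form (scale c y) x = c * form y x"
  "form x 0 = 0" "form 0 x = 0" "form (- y) x = - form y x" "form x (- y) = - form x y"
proof -
  have a: "form x (y + z) = form x y + form x z" and s: "form x (scale c y) = c * form x y"
    for x y z c using form_linear[of x] by (auto simp: linear_mult_iff)
  show "form x (y + z) = form x y + form x z" "form x (scale c y) = c * form x y"
    by (rule a s)+
  show "form (y + z) x = form y x + form z x" "form (scale c y) x = c * form y x"
    using a s form_sym by metis+
  show z: "form x 0 = 0" "form 0 x = 0"
    using s[of x 0 0] form_sym by auto
  show "form (- y) x = - form y x" "form x (- y) = - form x y"
    using a[of x y "- y"] z form_sym by (auto simp: add_eq_0_iff)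
qed

lemma form_sum_left: "form (\<Sum>i\<in>A. f i) x = (\<Sum>i\<in>A. form (f i) x)"
  by (induction A rule: infinite_finite_induct) (auto simp: form_simps)

lemma form_eqI: "(\<And>z. form x z = form y z) \<Longrightarrow> x = y"
  using form_nondegenerate[of "x - y"] form_simps(3)[of x "- y"] by (auto simp: form_simps)

theorem mu_sum:
  "mu scale form (\<Sum>i<k. pure_tensor form (a i) (b i) (c i)) x y =
     (\<Sum>i<k. scale (form (a i) x * form (b i) y) (c i))" for k :: nat
  unfolding mu_def
proof (rule the_equality)
  show "\<exists>k' a' b' c'. (\<Sum>i<k. pure_tensor form (a i) (b i) (c i)) =
      (\<Sum>i<(k'::nat). pure_tensor form (a' i) (b' i) (c' i)) \<and>
      (\<Sum>i<k. scale (form (a i) x * form (b i) y) (c i)) =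
      (\<Sum>i<k'. scale (form (a' i) x * form (b' i) y) (c' i))"
    by blast
next
  fix m
  assume "\<exists>k' a' b' c'. (\<Sum>i<k. pure_tensor form (a i) (b i) (c i)) =
      (\<Sum>i<(k'::nat). pure_tensor form (a' i) (b' i) (c' i)) \<and>
      m = (\<Sum>i<k'. scale (form (a' i) x * form (b' i) y) (c' i))"
  then obtain k' :: nat and a' b' c' where
    T: "(\<Sum>i<k. pure_tensor form (a i) (b i) (c i)) =
      (\<Sum>i<k'. pure_tensor form (a' i) (b' i) (c' i))"
    and m: "m = (\<Sum>i<k'. scale (form (a' i) x * form (b' i) y) (c' i))"
    by blast
  show "m = (\<Sum>i<k. scale (form (a i) x * form (b i) y) (c i))"
  proof (rule form_eqI)
    fix z
    show "form m z = form (\<Sum>i<k. scale (form (a i) x * form (b i) y) (c i)) z"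
      using fun_cong[OF T, of "(x, y, z)"]
      by (simp add: m form_sum_left form_simps sum_fun_apply pure_tensor_def)
  qed
qed

lemma form_mu:
  assumes "T \<in> tensor3 form"
  shows "form (mu scale form T x y) z = T (x, y, z)"
proof -
  obtain k :: nat and a b c where T: "T = (\<Sum>i<k. pure_tensor form (a i) (b i) (c i))"
    using assms by (auto simp: tensor3_def)
  show ?thesis
    unfolding T mu_sum by (simp add: form_sum_left form_simps sum_fun_apply pure_tensor_def)
qed

lemma robeva_alt:
  assumes "T \<in> sym_tensor3 form"
  shows "robeva scale form x y z w T =
    form (mu scale form T y z) (mu scale form T x w) -
    form (mu scale form T x y) (mu scale form T z w)"
proof -
  let ?m = "mu scale form T"
  have T: "T \<in> tensor3 form" and s1: "\<And>x y z. T (y, x, z) = T (x, y, z)"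
    and s2: "\<And>x y z. T (x, z, y) = T (x, y, z)"
    using assms by (auto simp: sym_tensor3_def)
  have "form (?m x (?m y z)) w = form (?m x w) (?m y z)"
    using s2 by (simp add: form_mu[OF T])
  moreover have "form (?m (?m x y) z) w = form (?m z w) (?m x y)"
    using s1 s2 by (metis form_mu[OF T])
  ultimately show ?thesis
    unfolding robeva_def by (metis form_sym)
qed

lemma strongly_odeco_sym: "strongly_odeco form T \<Longrightarrow> T \<in> sym_tensor3 form"
  unfolding strongly_odeco_def sym_tensor3_def tensor3_def
  by (auto simp: sum_fun_apply pure_tensor_def mult_ac)

lemma functional_representation:
  assumes "Vector_Spaces.linear scale (*) f"
  shows "\<exists>u. form u = f"
proof -
  obtain B0 where B0: "finite B0" "span B0 = UNIV" using finite_dimensional by auto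
  obtain B where B: "B \<subseteq> B0" "independent B" "B0 \<subseteq> span B"
    using maximal_independent_subset by blast
  have "span B = UNIV" using B B0 by (metis span_mono span_span top.extremum_uniqueI)
  then interpret fd: finite_dimensional_vector_space scale B
    using B finite_subset[OF B(1) B0(1)] by unfold_locales auto
  define F where "F u = (\<Sum>b\<in>B. scale (form u b) b)" for u
  have f: "f (x + y) = f x + f y" "f (scale c x) = c * f x" for x y c
    using assms by (auto simp: linear_mult_iff)
  have ext: "form u = f" if eq: "\<And>b. b \<in> B \<Longrightarrow> form u b = f b"
    and f: "\<And>x y. f (x + y) = f x + f y" "\<And>x c. f (scale c x) = c * f x" for u f
  proof
    fix x
    have "x \<in> span B" using fd.span_Basis by auto
    then show "form u x = f x"
    proof (induction rule: span_induct_alt)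
      case base then show ?case using f(2)[of 0 0] by (auto simp: form_simps)
    next
      case (step c x y) then show ?case using f eq by (auto simp: form_simps)
    qed
  qed
  have coeff: "\<forall>b\<in>B. g b = h b" if "(\<Sum>b\<in>B. scale (g b) b) = (\<Sum>b\<in>B. scale (h b) b)" for g h
  proof -
    have "(\<Sum>b\<in>B. scale (g b - h b) b) = 0"
      using that by (simp add: scale_left_diff_distrib sum_subtractf)
    then show ?thesis
      using independentD[OF B(2) fd.finite_Basis order_refl, of "\<lambda>b. g b - h b"] by auto
  qed
  have lin: "Vector_Spaces.linear scale scale F"
    unfolding F_def
    by unfold_locales
      (auto simp: form_simps scale_left_distrib sum.distrib scale_sum_right)
  have "inj F"
  proof (rule injI)
    fix u v assume "F u = F v"
    then have "\<forall>b\<in>B. form u b = form v b" unfolding F_def by (rule coeff)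
    then have "form u = form v" by (intro ext) (auto simp: form_simps)
    then show "u = v" by (intro form_eqI) auto
  qed
  then have "surj F" using fd.linear_inj_imp_surj[OF lin] by blast
  then obtain u where "F u = (\<Sum>b\<in>B. scale (f b) b)" by (metis surjD)
  then have "\<forall>b\<in>B. form u b = f b" unfolding F_def by (rule coeff)
  then show ?thesis using ext f by blast
qed

text \<open>Universal property: every trilinear form on \<open>V \<times> V \<times> V\<close> factors through \<open>tensor3\<close>.\<close>

theorem tensor3_universal:
  fixes \<phi> :: "'v \<Rightarrow> 'v \<Rightarrow> 'v \<Rightarrow> complex"
  assumes \<phi>: "\<And>b c. Vector_Spaces.linear scale (*) (\<lambda>a. \<phi> a b c)"
    "\<And>a c. Vector_Spaces.linear scale (*) (\<lambda>b. \<phi> a b c)"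
    "\<And>a b. Vector_Spaces.linear scale (*) (\<lambda>c. \<phi> a b c)"
  shows "\<exists>L \<in> linear_functionals (tensor3 form). \<forall>a b c. L (pure_tensor form a b c) = \<phi> a b c"
proof -
  obtain B0 where B0: "finite B0" "span B0 = UNIV" using finite_dimensional by auto
  obtain B where B: "B \<subseteq> B0" "independent B" "B0 \<subseteq> span B"
    using maximal_independent_subset by blast
  have spB: "span B = UNIV" using B B0 by (metis span_mono span_span top.extremum_uniqueI)
  have finB: "finite B" using finite_subset[OF B(1) B0(1)] .
  have "\<exists>u. form u = (\<lambda>x. representation B x b)" for b
    by (rule functional_representation)
      (auto simp: linear_mult_iff representation_add[OF B(2)] representation_scale[OF B(2)] spB
        vector_space_axioms)
  then obtain u where u: "\<And>b x. form (u b) x = representation B x b" by metis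
  have expand: "g x = (\<Sum>b\<in>B. form x (u b) * g b)" if g: "Vector_Spaces.linear scale (*) g" for g x
  proof -
    have "x = (\<Sum>b\<in>B. scale (form x (u b)) b)"
      using sum_representation_eq[OF B(2), of x B] finB spB u form_sym by auto
    then have "g x = g (\<Sum>b\<in>B. scale (form x (u b)) b)" by simp
    also have "\<dots> = (\<Sum>b\<in>B. form x (u b) * g b)"
    proof -
      have "g 0 = 0" using g unfolding linear_mult_iff by (metis add_cancel_right_right)
      then show ?thesis
        using g by (induction B rule: infinite_finite_induct) (auto simp: linear_mult_iff)
    qed
    finally show ?thesis .
  qed
  define L where "L T = (\<Sum>i\<in>B. \<Sum>j\<in>B. \<Sum>k\<in>B. T (u i, u j, u k) * \<phi> i j k)" for T
  have "L \<in> linear_functionals (tensor3 form)"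
    unfolding linear_functionals_def L_def
    by (auto simp: fun_scale_def ring_distribs sum.distrib sum_distrib_left mult.assoc)
  moreover have "L (pure_tensor form a b c) = \<phi> a b c" for a b c
  proof -
    have "\<phi> a b c = (\<Sum>i\<in>B. form a (u i) * \<phi> i b c)"
      by (rule expand[OF \<phi>(1)])
    also have "\<dots> = (\<Sum>i\<in>B. form a (u i) * (\<Sum>j\<in>B. form b (u j) * \<phi> i j c))"
      by (subst expand[OF \<phi>(2)]) simp
    also have "\<dots> = (\<Sum>i\<in>B. form a (u i) * (\<Sum>j\<in>B. form b (u j) * (\<Sum>k\<in>B. form c (u k) * \<phi> i j k)))"
      by (subst expand[OF \<phi>(3)]) simp
    also have "\<dots> = L (pure_tensor form a b c)"
      by (simp add: L_def pure_tensor_def sum_distrib_left mult.assoc)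
    finally show ?thesis by simp
  qed
  ultimately show ?thesis by blast
qed

end

end

(* A quadric q on symmetric tensors is determined by its polarization on pairs of cubes,
   P(v,w) = q(v^3 + w^3) - q(v^3) - q(w^3), a symmetric bihomogeneous function of bidegree (3,3).
   If q vanishes on strongly odeco tensors, then P vanishes on all orthogonal pairs of
   non-isotropic vectors, hence P = (v|w) R(v,w) with R of bidegree (2,2), and R(v,v) = 0
   because P does so on the diagonal. A symmetric such R is a combination of the minors
   ab(v)cd(w) + cd(v)ab(w) - ac(v)bd(w) - bd(v)ac(w), and (v|w) times such a minor is the
   polarization of one of Robeva's equations. *)
theory Submission
  imports Defs "HOL-Computational_Algebra.Polynomial"
begin

context quadratic_space
begin

text \<open>Divisibility by (v|w) is proved by explicit division. With (e|e) = 1, x = (e|v) and y =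
  (e|w), the form is x y plus a form in the components orthogonal to e, so every product x y can be
  traded away. This also covers dimension one, where the form factors as x y and generates an ideal
  that is radical but not prime. The vanishing of P is known only off the isotropic vectors; instead
  of a density argument, everything is restricted to a curve with one parameter, where polynomials
  have no zero divisors. The diagonal is a separate matter, because a non-isotropic v is not
  orthogonal to itself: there P vanishes because 2 v^3 is again the cube of a multiple of v.\<close>

lemma form_diff: "form x (y - z) = form x y - form x z" "form (y - z) x = form y x - form z x"
  using form_simps(1)[of x y "- z"] form_simps(3)[of y "- z" x] by (auto simp: form_simps)

lemma linear_form: "Vector_Spaces.linear scale (*) (\<lambda>x. form x a)"
  by (auto simp: linear_mult_iff form_simps vector_space_axioms)

text \<open>Nondegeneracy represents each coordinate functional of a finite basis as
  \<open>form (u b)\<close>. Expanding functionals rather than vectors lets multilinear expressions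
  be expanded one slot at a time.\<close>

lemma dual_basis:
  obtains B :: "'v set" and u where "finite B"
    "\<And>g x. Vector_Spaces.linear scale (*) g \<Longrightarrow> g x = (\<Sum>b\<in>B. form (u b) x * g b)"
proof -
  obtain B0 where B0: "finite B0" "span B0 = UNIV" using finite_dimensional by auto
  obtain B where B: "B \<subseteq> B0" "independent B" "B0 \<subseteq> span B"
    using maximal_independent_subset by blast
  have spB: "span B = UNIV" using B B0 by (metis span_mono span_span top.extremum_uniqueI)
  have finB: "finite B" using finite_subset[OF B(1) B0(1)] .
  have "\<exists>u. form u = (\<lambda>x. representation B x b)" for b
    by (rule functional_representation)
      (auto simp: linear_mult_iff representation_add[OF B(2)] representation_scale[OF B(2)] spB
        vector_space_axioms)
  then obtain u where u: "\<And>b x. form (u b) x = representation B x b" by metis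
  have "g x = (\<Sum>b\<in>B. form (u b) x * g b)" if g: "Vector_Spaces.linear scale (*) g" for g x
  proof -
    have add: "g (y + z) = g y + g z" and mul: "g (scale c y) = c * g y" for y z c
      using g by (auto simp: linear_mult_iff)
    have "g 0 = 0" using mul[of 0 0] by simp
    then have sum: "g (\<Sum>b\<in>A. f b) = (\<Sum>b\<in>A. g (f b))" for A and f :: "'v \<Rightarrow> 'v"
      by (induction A rule: infinite_finite_induct) (auto simp: add)
    have "x = (\<Sum>b\<in>B. scale (form (u b) x) b)"
      using sum_representation_eq[OF B(2), of x B] finB spB u by auto
    then have "g x = g (\<Sum>b\<in>B. scale (form (u b) x) b)" by simp
    then show ?thesis by (simp add: sum mul)
  qed
  with finB show ?thesis using that by blast
qed


section \<open>Bihomogeneous functions\<close>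

text \<open>Polynomials without a choice of coordinates: linear forms are \<open>form a\<close>.
  With \<open>p\<close> the identity these are the bihomogeneous polynomials in \<open>v\<close> and
  \<open>w\<close>; with \<open>p = proj e\<close> they are those that do not involve the
  \<open>e\<close>-components.\<close>

inductive bihom :: "('v \<Rightarrow> 'v) \<Rightarrow> nat \<Rightarrow> nat \<Rightarrow> ('v \<Rightarrow> 'v \<Rightarrow> complex) \<Rightarrow> bool" for p where
  const: "bihom p 0 0 (\<lambda>v w. c)"
| zero: "bihom p m n (\<lambda>v w. 0)"
| add: "bihom p m n f \<Longrightarrow> bihom p m n g \<Longrightarrow> bihom p m n (\<lambda>v w. f v w + g v w)"
| left: "bihom p m n f \<Longrightarrow> bihom p (Suc m) n (\<lambda>v w. form a (p v) * f v w)"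
| right: "bihom p m n f \<Longrightarrow> bihom p m (Suc n) (\<lambda>v w. form a (p w) * f v w)"

lemma bihom_cmult: "bihom p m n f \<Longrightarrow> bihom p m n (\<lambda>v w. c * f v w)"
proof (induction rule: bihom.induct)
  case (left m n f a)
  then show ?case using bihom.left[OF left.IH, of a] by (simp add: mult.left_commute)
next
  case (right m n f a)
  then show ?case using bihom.right[OF right.IH, of a] by (simp add: mult.left_commute)
qed (auto simp: ring_distribs intro: bihom.intros)

lemma bihom_mult:
  "bihom p m n f \<Longrightarrow> bihom p m' n' g \<Longrightarrow> bihom p (m + m') (n + n') (\<lambda>v w. f v w * g v w)"
  by (induction rule: bihom.induct)
    (auto simp: ring_distribs mult.assoc intro: bihom.intros bihom_cmult)

lemma bihom_swap: "bihom p m n f \<Longrightarrow> bihom p n m (\<lambda>v w. f w v)"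
  by (induction rule: bihom.induct) (auto intro: bihom.intros)

lemma bihom_sum:
  "(\<And>i. i \<in> I \<Longrightarrow> bihom p m n (f i)) \<Longrightarrow> bihom p m n (\<lambda>v w. \<Sum>i\<in>I. f i v w)"
  by (induction I rule: infinite_finite_induct) (auto intro: bihom.intros)

lemma bihom_form: "bihom p 1 1 (\<lambda>v w. form (p v) (p w))"
proof -
  obtain B :: "'v set" and u where B: "finite B"
    "\<And>g x. Vector_Spaces.linear scale (*) g \<Longrightarrow> g x = (\<Sum>b\<in>B. form (u b) x * g b)"
    using dual_basis by blast
  have "form (p v) (p w) = (\<Sum>b\<in>B. form (u b) (p v) * (form b (p w) * 1))" for v w
    using B(2)[OF linear_form[of "p w"], of "p v"] by simp
  moreover have "bihom p 1 1 (\<lambda>v w. \<Sum>b\<in>B. form (u b) (p v) * (form b (p w) * 1))"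
    unfolding One_nat_def by (intro bihom_sum bihom.left bihom.right bihom.const)
  ultimately show ?thesis by simp
qed

text \<open>Moving \<open>p\<close> to the fixed vector turns a polynomial in the projected
  variables into one in the original variables, of the same bidegree.\<close>

lemma bihom_self_adjoint:
  assumes "\<And>a v. form a (p v) = form (p a) v"
  shows "bihom p m n f \<Longrightarrow> bihom (\<lambda>x. x) m n f"
proof (induction rule: bihom.induct)
  case (left m n f a)
  then show ?case using bihom.left[OF left.IH, of "p a"] by (simp add: assms)
next
  case (right m n f a)
  then show ?case using bihom.right[OF right.IH, of "p a"] by (simp add: assms)
qed (auto intro: bihom.intros)

lemma bihom_cong:
  "bihom p m n f \<Longrightarrow> p v = p v' \<Longrightarrow> p w = p w' \<Longrightarrow> f v w = f v' w'"
  by (induction rule: bihom.induct) auto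

lemma bihom_vanish:
  "bihom p m n f \<Longrightarrow> m + n > 0 \<Longrightarrow> p v = 0 \<Longrightarrow> p w = 0 \<Longrightarrow> f v w = 0"
  by (induction rule: bihom.induct) (auto simp: form_simps)

lemma bihom_poly:
  assumes p: "\<And>t v w. p (v + scale t w) = p v + scale t (p w)"
  shows "bihom p m n f \<Longrightarrow> \<exists>P. \<forall>t. f (v + scale t v0) (w + scale t w0) = poly P t"
proof (induction rule: bihom.induct)
  case (const c)
  show ?case by (rule exI[of _ "[:c:]"]) simp
next
  case zero
  show ?case by (rule exI[of _ 0]) simp
next
  case (add m n f g)
  then show ?case by (metis poly_add)
next
  case (left m n f a)
  then obtain P where "\<forall>t. f (v + scale t v0) (w + scale t w0) = poly P t" by blast
  then show ?case
    by (intro exI[of _ "[:form a (p v), form a (p v0):] * P"]) (simp add: p form_simps algebra_simps)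
next
  case (right m n f a)
  then obtain P where "\<forall>t. f (v + scale t v0) (w + scale t w0) = poly P t" by blast
  then show ?case
    by (intro exI[of _ "[:form a (p w), form a (p w0):] * P"]) (simp add: p form_simps algebra_simps)
qed

text \<open>On the line from \<open>(v, w)\<close> to \<open>(v0, w0)\<close> both factors become
  univariate polynomials, and the second is nonzero at parameter 1. The product is required to
  vanish on this line only, so the lemma also applies inside the diagonal.\<close>

lemma bihom_mult_eq_0_on_line:
  assumes p: "\<And>t v w. p (v + scale t w) = p v + scale t (p w)"
    and f: "bihom p m n f" and g: "bihom p m' n' g" and g0: "g v0 w0 \<noteq> 0"
    and fg: "\<And>t. f (v + scale t (v0 - v)) (w + scale t (w0 - w)) *
                 g (v + scale t (v0 - v)) (w + scale t (w0 - w)) = 0"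
  shows "f v w = 0"
proof -
  obtain F where F: "\<And>t. f (v + scale t (v0 - v)) (w + scale t (w0 - w)) = poly F t"
    using bihom_poly[OF p f] by blast
  obtain G where G: "\<And>t. g (v + scale t (v0 - v)) (w + scale t (w0 - w)) = poly G t"
    using bihom_poly[OF p g] by blast
  have "poly (F * G) t = 0" for t using fg[of t] by (simp add: F G)
  then have "F * G = 0" using poly_all_0_iff_0 by blast
  moreover have "poly G 1 \<noteq> 0" using G[of 1] g0 by simp
  ultimately have "F = 0" by auto
  then show ?thesis using F[of 0] by simp
qed

lemma bihom_mult_eq_0:
  assumes p: "\<And>t v w. p (v + scale t w) = p v + scale t (p w)"
    and "bihom p m n f" "bihom p m' n' g" "g v0 w0 \<noteq> 0" "\<And>v w. f v w * g v w = 0"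
  shows "f v w = 0"
  by (rule bihom_mult_eq_0_on_line[OF p assms(2-4)]) (rule assms(5))

text \<open>Explicit monomials, so that a claim linear in \<open>f\<close> can be checked on one
  product of linear forms at a time.\<close>

lemma bihom_list:
  "bihom (\<lambda>x. x) m n f \<Longrightarrow> \<exists>L. (\<forall>(c, as, bs)\<in>set L. length as = m \<and> length bs = n) \<and>
     (\<forall>v w. f v w = (\<Sum>(c, as, bs)\<leftarrow>L. c * (\<Prod>a\<leftarrow>as. form a v) * (\<Prod>b\<leftarrow>bs. form b w)))"
proof (induction rule: bihom.induct)
  case (const c)
  show ?case by (rule exI[of _ "[(c, [], [])]"]) simp
next
  case zero
  show ?case by (rule exI[of _ "[]"]) simp
next
  case (add m n f g)
  then obtain L L' where
    "\<forall>(c, as, bs)\<in>set L. length as = m \<and> length bs = n"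
    "\<forall>v w. f v w = (\<Sum>(c, as, bs)\<leftarrow>L. c * (\<Prod>a\<leftarrow>as. form a v) * (\<Prod>b\<leftarrow>bs. form b w))"
    "\<forall>(c, as, bs)\<in>set L'. length as = m \<and> length bs = n"
    "\<forall>v w. g v w = (\<Sum>(c, as, bs)\<leftarrow>L'. c * (\<Prod>a\<leftarrow>as. form a v) * (\<Prod>b\<leftarrow>bs. form b w))"
    by blast
  then show ?case by (intro exI[of _ "L @ L'"]) auto
next
  case (left m n f a)
  then obtain L where L:
    "\<forall>(c, as, bs)\<in>set L. length as = m \<and> length bs = n"
    "\<forall>v w. f v w = (\<Sum>(c, as, bs)\<leftarrow>L. c * (\<Prod>a\<leftarrow>as. form a v) * (\<Prod>b\<leftarrow>bs. form b w))"
    by blast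
  then show ?case
    by (intro exI[of _ "map (\<lambda>(c, as, bs). (c, a # as, bs)) L"])
      (auto simp: sum_list_const_mult[symmetric] o_def case_prod_unfold mult_ac)
next
  case (right m n f b)
  then obtain L where L:
    "\<forall>(c, as, bs)\<in>set L. length as = m \<and> length bs = n"
    "\<forall>v w. f v w = (\<Sum>(c, as, bs)\<leftarrow>L. c * (\<Prod>a\<leftarrow>as. form a v) * (\<Prod>b\<leftarrow>bs. form b w))"
    by blast
  then show ?case
    by (intro exI[of _ "map (\<lambda>(c, as, bs). (c, as, b # bs)) L"])
      (auto simp: sum_list_const_mult[symmetric] o_def case_prod_unfold mult_ac)
qed


section \<open>Divisibility by the bilinear form\<close>

text \<open>For \<open>form e e = 1\<close>, the orthogonal projection onto the complement of
  \<open>e\<close>.\<close>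

definition proj :: "'v \<Rightarrow> 'v \<Rightarrow> 'v" where
  "proj e v = v - scale (form e v) e"

lemma form_proj: "form a (proj e v) = form (proj e a) v"
  by (simp add: proj_def form_diff form_simps form_sym)

lemma proj_line: "proj e (v + scale t w) = proj e v + scale t (proj e w)"
  by (simp add: proj_def form_simps scale_left_distrib scale_right_diff_distrib)

lemma form_split: "form a v = form a e * form e v + form a (proj e v)"
  by (simp add: proj_def form_diff form_simps)

text \<open>Normal forms for division by \<open>form v w\<close>, whose leading monomial is \<open>xy\<close> for \<open>x = form e v\<close>
  and \<open>y = form e w\<close>: every remainder is free of \<open>x\<close> or free of \<open>y\<close>.\<close>

inductive red :: "'v \<Rightarrow> nat \<Rightarrow> nat \<Rightarrow> ('v \<Rightarrow> 'v \<Rightarrow> complex) \<Rightarrow> bool" for e where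
  zero: "red e m n (\<lambda>v w. 0)"
| add: "red e m n f \<Longrightarrow> red e m n g \<Longrightarrow> red e m n (\<lambda>v w. f v w + g v w)"
| ideal: "bihom (\<lambda>x. x) m n R \<Longrightarrow> red e (Suc m) (Suc n) (\<lambda>v w. form v w * R v w)"
| left: "bihom (proj e) m n A \<Longrightarrow> red e (m + k) n (\<lambda>v w. form e v ^ k * A v w)"
| right: "bihom (proj e) m n A \<Longrightarrow> red e m (n + k) (\<lambda>v w. form e w ^ k * A v w)"

lemma red_swap: "red e m n f \<Longrightarrow> red e n m (\<lambda>v w. f w v)"
proof (induction rule: red.induct)
  case (ideal m n R)
  show ?case using red.ideal[OF bihom_swap[OF ideal]] by (simp add: form_sym)
qed (auto intro: red.intros dest: bihom_swap)

text \<open>Splitting \<open>form a v\<close> into its \<open>form e v\<close> part and its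
  projected part keeps every shape normal, except that \<open>form e v\<close> may meet a positive
  power of \<open>form e w\<close>; only there is a division needed.\<close>

lemma red_left:
  assumes e: "form e e = 1"
  shows "red e m n f \<Longrightarrow> red e (Suc m) n (\<lambda>v w. form a v * f v w)"
proof (induction rule: red.induct)
  case (zero m n)
  then show ?case by (simp add: red.zero)
next
  case (add m n f g)
  then show ?case by (simp add: ring_distribs red.add)
next
  case (ideal m n R)
  then show ?case
    using red.ideal[OF bihom.left[OF ideal, of a]] by (simp add: mult.left_commute)
next
  case (left m n A k)
  have "form a v * (form e v ^ k * A v w) =
      form e v ^ Suc k * (form a e * A v w) + form e v ^ k * (form a (proj e v) * A v w)" for v w
    by (subst form_split[of a v e]) (simp add: algebra_simps)
  then show ?case
    using red.add[OF red.left[OF bihom_cmult[OF left, of "form a e"], of "Suc k"]]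
      red.left[OF bihom.left[OF left, of a], of k] by simp
next
  case (right m n A k)
  show ?case
  proof (cases k)
    \<comment> \<open>Without a power of \<open>form e w\<close> the term counts as a
      \<open>left\<close> term, so multiplying by \<open>form e v\<close> is harmless.\<close>
    case 0
    have "form a v * A v w =
        form e v ^ 1 * (form a e * A v w) + form e v ^ 0 * (form a (proj e v) * A v w)" for v w
      by (subst form_split[of a v e]) (simp add: algebra_simps)
    then show ?thesis
      using red.add[OF red.left[OF bihom_cmult[OF right, of "form a e"], of 1]]
        red.left[OF bihom.left[OF right, of a], of 0] 0 by simp
  next
    case (Suc j)
    have pw: "bihom (\<lambda>x. x) 0 j (\<lambda>v w. form e w ^ j)" for j
      by (induction j) (use bihom.right[of "\<lambda>x. x" 0 _ _ e] bihom.const[of "\<lambda>x. x" 1] in auto)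
    have "bihom (\<lambda>x. x) m (n + j) (\<lambda>v w. form a e * (form e w ^ j * A v w))"
      using bihom_cmult[OF bihom_mult[OF pw[of j] bihom_self_adjoint[OF form_proj right]],
          where c = "form a e"]
      by (simp add: add.commute)
    from red.ideal[OF this]
    have 1: "red e (Suc m) (n + k) (\<lambda>v w. form v w * (form a e * (form e w ^ j * A v w)))"
      by (simp add: Suc)
    have 2: "red e (Suc m) (n + k) (\<lambda>v w. form e w ^ j *
        (- form a e * (form (proj e v) (proj e w) * A v w)))"
      using red.right[OF bihom_cmult[OF bihom_mult[OF bihom_form right], of "- form a e"], of j]
      by (simp add: Suc)
    have 3: "red e (Suc m) (n + k) (\<lambda>v w. form e w ^ k * (form a (proj e v) * A v w))"
      using red.right[OF bihom.left[OF right, of a], of k] by simp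
    \<comment> \<open>The division step: the first summand yields a term in the ideal, the second
      one lowers the power of \<open>form e w\<close> by one.\<close>
    have xy: "form e v * form e w = form v w - form (proj e v) (proj e w)" for v w
      by (simp add: proj_def form_diff form_simps e form_sym[of v e] algebra_simps)
    have "form a v * (form e w ^ k * A v w) =
       form v w * (form a e * (form e w ^ j * A v w)) +
       form e w ^ j * (- form a e * (form (proj e v) (proj e w) * A v w)) +
       form e w ^ k * (form a (proj e v) * A v w)" for v w
    proof -
      have "form a v * (form e w ^ k * A v w) =
          form a e * (form e v * form e w) * (form e w ^ j * A v w) +
          form e w ^ k * (form a (proj e v) * A v w)"
        by (subst form_split[of a v e]) (simp add: Suc algebra_simps)
      then show ?thesis unfolding xy by (simp add: algebra_simps)
    qed
    then show ?thesis using red.add[OF red.add[OF 1 2] 3] by simp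
  qed
qed

lemma bihom_red:
  assumes e: "form e e = 1"
  shows "bihom (\<lambda>x. x) m n f \<Longrightarrow> red e m n f"
proof (induction rule: bihom.induct)
  case (const c)
  then show ?case using red.left[OF bihom.const, of e 0 c] by simp
next
  case (left m n f a)
  then show ?case using red_left[OF e left.IH] by simp
next
  case (right m n f a)
  then show ?case using red_swap[OF red_left[OF e red_swap[OF right.IH]]] by simp
qed (auto intro: red.intros)

lemma sum_powers_delta:
  "(\<Sum>i\<le>m. c ^ i * (if i = k then A else (\<lambda>v w. 0)) v w) = (if k \<le> m then c ^ k * A v w else 0)"
  for c :: complex and k m :: nat
proof -
  have "(\<Sum>i\<le>m. c ^ i * (if i = k then A else (\<lambda>v w. 0)) v w) =
      (\<Sum>i\<le>m. if i = k then c ^ k * A v w else 0)"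
    by (rule sum.cong) auto
  then show ?thesis by simp
qed

text \<open>Equal exponents are collected. A term of exponent 0 would fit both sums; it is assigned
  to \<open>A\<close>, whence \<open>B 0\<close> is zero and no monomial is listed twice.\<close>

lemma red_normal_form:
  "red e m n f \<Longrightarrow> \<exists>R A B. bihom (\<lambda>x. x) (m - 1) (n - 1) R \<and>
     (\<forall>i\<le>m. bihom (proj e) (m - i) n (A i)) \<and> (\<forall>i\<le>n. bihom (proj e) m (n - i) (B i)) \<and>
     B 0 = (\<lambda>v w. 0) \<and>
     (\<forall>v w. f v w = form v w * R v w + (\<Sum>i\<le>m. form e v ^ i * A i v w) +
        (\<Sum>i\<le>n. form e w ^ i * B i v w))"
proof (induction rule: red.induct)
  case zero
  show ?case
    by (rule exI[of _ "\<lambda>v w. 0"] exI[of _ "\<lambda>i v w. 0"])+ (simp add: bihom.zero)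
next
  case (add m n f g)
  then obtain R A B R' A' B' where "bihom (\<lambda>x. x) (m - 1) (n - 1) R"
     "\<forall>i\<le>m. bihom (proj e) (m - i) n (A i)" "\<forall>i\<le>n. bihom (proj e) m (n - i) (B i)"
     "B 0 = (\<lambda>v w. 0)"
     "\<forall>v w. f v w = form v w * R v w + (\<Sum>i\<le>m. form e v ^ i * A i v w) +
        (\<Sum>i\<le>n. form e w ^ i * B i v w)"
     "bihom (\<lambda>x. x) (m - 1) (n - 1) R'"
     "\<forall>i\<le>m. bihom (proj e) (m - i) n (A' i)" "\<forall>i\<le>n. bihom (proj e) m (n - i) (B' i)"
     "B' 0 = (\<lambda>v w. 0)"
     "\<forall>v w. g v w = form v w * R' v w + (\<Sum>i\<le>m. form e v ^ i * A' i v w) +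
        (\<Sum>i\<le>n. form e w ^ i * B' i v w)" by blast
  then show ?case
    by - (rule exI[of _ "\<lambda>v w. R v w + R' v w"],
        rule exI[of _ "\<lambda>i v w. A i v w + A' i v w"],
        rule exI[of _ "\<lambda>i v w. B i v w + B' i v w"],
        auto intro: bihom.add simp: ring_distribs sum.distrib)
next
  case (ideal m n R)
  then show ?case
    by (intro exI[of _ R] exI[of _ "\<lambda>i v w. 0"]) (simp add: bihom.zero)
next
  case (left m n A k)
  show ?case
    by (rule exI[of _ "\<lambda>v w. 0"], rule exI[of _ "\<lambda>i. if i = k then A else (\<lambda>v w. 0)"],
        rule exI[of _ "\<lambda>i v w. 0"])
      (use left in \<open>auto simp: bihom.zero sum_powers_delta\<close>)
next
  case (right m n A k)
  show ?case
  proof (cases "k = 0")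
    case True
    show ?thesis
      by (rule exI[of _ "\<lambda>v w. 0"], rule exI[of _ "\<lambda>i. if i = k then A else (\<lambda>v w. 0)"],
          rule exI[of _ "\<lambda>i v w. 0"])
        (use right True in \<open>auto simp: bihom.zero sum_powers_delta\<close>)
  next
    case False
    show ?thesis
      by (rule exI[of _ "\<lambda>v w. 0"], rule exI[of _ "\<lambda>i v w. 0"],
          rule exI[of _ "\<lambda>i. if i = k then A else (\<lambda>v w. 0)"])
        (use right False in \<open>auto simp: bihom.zero sum_powers_delta\<close>)
  qed
qed

lemma divisible_by_form:
  assumes e: "form e e = 1" and k: "k > 0" and P: "bihom (\<lambda>x. x) k k P"
    and P0: "\<And>v w. form v w = 0 \<Longrightarrow> form v v \<noteq> 0 \<Longrightarrow> form w w \<noteq> 0 \<Longrightarrow> P v w = 0"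
  obtains R where "bihom (\<lambda>x. x) (k - 1) (k - 1) R" "\<And>v w. P v w = form v w * R v w"
proof -
  obtain R A B where R: "bihom (\<lambda>x. x) (k - 1) (k - 1) R"
     and A: "\<And>i. i \<le> k \<Longrightarrow> bihom (proj e) (k - i) k (A i)"
     and B: "\<And>i. i \<le> k \<Longrightarrow> bihom (proj e) k (k - i) (B i)"
     and B0: "B 0 = (\<lambda>v w. 0)"
     and P_eq: "\<And>v w. P v w = form v w * R v w + (\<Sum>i\<le>k. form e v ^ i * A i v w) +
        (\<Sum>i\<le>k. form e w ^ i * B i v w)"
    using red_normal_form[OF bihom_red[OF e P]] by blast
  txt \<open>Fix the projections of \<open>v\<close> and \<open>w\<close> and move \<open>x = s\<close>, \<open>y = c / s\<close> along the hyperbola on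
    which \<open>v\<close> and \<open>w\<close> are orthogonal: the remainder is a Laurent polynomial in \<open>s\<close>, with
    coefficients \<open>A i\<close> and \<open>c ^ i * B i\<close>, that vanishes identically.\<close>
  have generic: "A i v w = 0 \<and> B i v w = 0"
    if c0: "form (proj e v) (proj e w) \<noteq> 0" and i: "i \<le> k" for i v w
  proof -
    define c where "c = - form (proj e v) (proj e w)"
    \<comment> \<open>The remainder times \<open>s ^ k\<close>, which clears the negative powers
      coming from \<open>(c / s) ^ i\<close>.\<close>
    define Q where "Q = (\<Sum>i\<le>k. monom (A i v w) (k + i)) + (\<Sum>i\<le>k. monom (c ^ i * B i v w) (k - i))"
    \<comment> \<open>\<open>?H\<close> takes the value \<open>form v' v'\<close> and
      \<open>?K\<close> the value \<open>s\<^sup>2 * form w' w'\<close> for the vectors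
      \<open>v'\<close>, \<open>w'\<close> below. As factors they absorb the parameters at which a
      vector is isotropic, and \<open>[:0, 1:]\<close> absorbs \<open>s = 0\<close>.
      \<open>?K\<close> is nonzero because \<open>c\<close> is.\<close>
    let ?H = "[:form (proj e v) (proj e v), 0, 1:]"
    let ?K = "[:c\<^sup>2, 0, form (proj e w) (proj e w):]"
    have ep: "form e (proj e x) = 0" "form (proj e x) e = 0" for x
      by (simp_all add: proj_def form_diff form_simps e form_sym[of x e])
    have "poly (Q * [:0, 1:] * ?H * ?K) s = 0" for s
    proof (cases "s = 0 \<or> poly ?H s = 0 \<or> poly ?K s = 0")
      case False
      then have s: "s \<noteq> 0" by simp
      define v' where "v' = scale s e + proj e v"
      define w' where "w' = scale (c / s) e + proj e w"
      have ev: "form e v' = s" and ew: "form e w' = c / s"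
        by (simp_all add: v'_def w'_def form_simps e ep)
      have pv: "proj e v' = proj e v" and pw: "proj e w' = proj e w"
        unfolding proj_def[of e v'] proj_def[of e w'] ev ew by (simp_all add: v'_def w'_def)
      have orth: "form v' w' = 0"
      proof -
        have "form v' w' = s * (c / s) + form (proj e v) (proj e w)"
          by (simp add: v'_def w'_def form_simps e ep)
        then show ?thesis using s by (simp add: c_def)
      qed
      have "form v' v' = poly ?H s"
        by (simp add: v'_def form_simps e ep power2_eq_square)
      moreover have "s\<^sup>2 * form w' w' = poly ?K s"
        using s by (simp add: w'_def form_simps e ep power2_eq_square field_simps)
      ultimately have "form v' v' \<noteq> 0" "form w' w' \<noteq> 0" using False by (metis mult_zero_right)+
      then have "P v' w' = 0" using P0[OF orth] by blast
      moreover have "A i v' w' = A i v w" "B i v' w' = B i v w" if "i \<le> k" for i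
        using bihom_cong[OF A[OF that] pv pw] bihom_cong[OF B[OF that] pv pw] by auto
      ultimately have "(\<Sum>i\<le>k. s ^ i * A i v w) + (\<Sum>i\<le>k. (c / s) ^ i * B i v w) = 0"
        using P_eq[of v' w'] by (simp add: orth ev ew)
      then have "0 = s ^ k * ((\<Sum>i\<le>k. s ^ i * A i v w) + (\<Sum>i\<le>k. (c / s) ^ i * B i v w))" by simp
      also have "\<dots> = (\<Sum>i\<le>k. s ^ (k + i) * A i v w) + (\<Sum>i\<le>k. s ^ (k - i) * (c ^ i * B i v w))"
        unfolding ring_distribs sum_distrib_left
        by (intro arg_cong2[of _ _ _ _ "(+)"] sum.cong refl)
          (use s in \<open>simp_all add: power_add power_diff power_divide field_simps\<close>)
      also have "\<dots> = poly Q s"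
        by (simp add: Q_def poly_sum poly_monom mult.commute)
      finally show ?thesis by simp
    next
      case True
      then show ?thesis unfolding poly_mult mult_eq_0_iff by auto
    qed
    then have "Q * [:0, 1:] * ?H * ?K = 0" using poly_all_0_iff_0 by blast
    moreover have "c \<noteq> 0" using c0 by (simp add: c_def)
    ultimately have Q0: "Q = 0" unfolding mult_eq_0_iff by auto
    \<comment> \<open>The exponents \<open>k + i\<close> and \<open>k - j\<close> meet only for
      \<open>i = j = 0\<close>, where \<open>B 0\<close> vanishes.\<close>
    have "coeff Q (k + i) = A i v w + (\<Sum>j\<le>k. if k - j = k + i then c ^ j * B j v w else 0)"
      using i by (simp add: Q_def coeff_sum)
    also have "(\<Sum>j\<le>k. if k - j = k + i then c ^ j * B j v w else 0) = 0"
      by (intro sum.neutral) (auto simp: B0 le_imp_diff_is_add)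
    finally have Ai: "A i v w = 0" using Q0 by simp
    have "B i v w = 0"
    proof (cases "i = 0")
      case False
      have "coeff Q (k - i) = (\<Sum>j\<le>k. if k - j = k - i then c ^ j * B j v w else 0)"
        using i False by (auto simp: Q_def coeff_sum intro!: sum.neutral)
      also have "\<dots> = (\<Sum>j\<le>k. if j = i then c ^ j * B j v w else 0)"
        using i by (intro sum.cong) auto
      finally show ?thesis using i Q0 \<open>c \<noteq> 0\<close> by simp
    qed (simp add: B0)
    with Ai show ?thesis by simp
  qed
  \<comment> \<open>The genericity condition is removed by cancelling the polynomial
    \<open>form (proj e v) (proj e w)\<close>, unless it is identically zero.\<close>
  have "A i v w = 0 \<and> B i v w = 0" if i: "i \<le> k" for i v w
  proof (cases "\<exists>v0 w0. form (proj e v0) (proj e w0) \<noteq> 0")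
    case True
    then obtain v0 w0 where "form (proj e v0) (proj e w0) \<noteq> 0" by blast
    note * = bihom_mult_eq_0[OF proj_line _ bihom_form this]
    show ?thesis using *[OF A[OF i]] *[OF B[OF i]] generic[OF _ i] by (metis mult_eq_0_iff)
  next
    \<comment> \<open>Here \<open>V\<close> is the line spanned by \<open>e\<close>: all projections
      are zero, and so are the coefficients, being of positive degree in them.\<close>
    case False
    have "proj e x = 0" for x
    proof (rule form_nondegenerate)
      fix y
      have "form (proj e x) e = 0" by (simp add: proj_def form_diff form_simps e form_sym[of x e])
      then show "form (proj e x) y = 0" using False form_split[of "proj e x" y e] by simp
    qed
    then show ?thesis using bihom_vanish[OF A[OF i]] bihom_vanish[OF B[OF i]] k by simp
  qed
  then have "P v w = form v w * R v w" for v w by (simp add: P_eq)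
  with R show ?thesis using that by blast
qed


section \<open>Quadratic functions on symmetric tensors\<close>

text \<open>As rewrite rules these are eta-contracted and would turn \<open>S + T\<close> into \<open>\<lambda>x. S x + T x\<close>.\<close>

declare plus_fun_apply [simp del] zero_fun_apply [simp del]

lemmas fun_apply = plus_fun_apply zero_fun_apply

abbreviation cube :: "'v \<Rightarrow> 'v \<times> 'v \<times> 'v \<Rightarrow> complex" where
  "cube v \<equiv> pure_tensor form v v v"

abbreviation W :: "('v \<times> 'v \<times> 'v \<Rightarrow> complex) set" where
  "W \<equiv> sym_tensor3 form"

section \<open>Symmetric tensors as sums of cubes\<close>

lemma tensor3_add_pure:
  assumes "T \<in> tensor3 form"
  shows "T + pure_tensor form x y z \<in> tensor3 form"
proof -
  obtain k :: nat and a b c where T: "T = (\<Sum>i<k. pure_tensor form (a i) (b i) (c i))"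
    using assms by (auto simp: tensor3_def)
  have "T + pure_tensor form x y z =
      (\<Sum>i<Suc k. pure_tensor form ((a(k := x)) i) ((b(k := y)) i) ((c(k := z)) i))"
    by (simp add: T)
  then show ?thesis unfolding tensor3_def by blast
qed

lemma tensor3_add:
  assumes S: "S \<in> tensor3 form" and T: "T \<in> tensor3 form"
  shows "S + T \<in> tensor3 form"
proof -
  obtain k :: nat and a b c where T: "T = (\<Sum>i<k. pure_tensor form (a i) (b i) (c i))"
    using T by (auto simp: tensor3_def)
  have "S + (\<Sum>i<k. pure_tensor form (a i) (b i) (c i)) \<in> tensor3 form"
  proof (induction k)
    case (Suc k)
    show ?case using tensor3_add_pure[OF Suc.IH] by (simp only: sum.lessThan_Suc add.assoc)
  qed (simp add: S)
  with T show ?thesis by simp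
qed

lemma tensor3_zero: "0 \<in> tensor3 form"
  unfolding tensor3_def by (auto intro!: exI[of _ 0])

lemma W_add: "S \<in> W \<Longrightarrow> T \<in> W \<Longrightarrow> S + T \<in> W"
  by (auto simp: sym_tensor3_def tensor3_add fun_apply)

lemma W_zero: "0 \<in> W"
  by (auto simp: sym_tensor3_def tensor3_zero fun_apply)

lemma W_cube: "cube v \<in> W"
  using tensor3_add_pure[OF tensor3_zero, of v v v] by (auto simp: sym_tensor3_def pure_tensor_def fun_apply)

lemma W_tensor3: "T \<in> W \<Longrightarrow> T \<in> tensor3 form"
  by (auto simp: sym_tensor3_def)

lemma cube_scale: "cube (scale c v) = fun_scale (c ^ 3) (cube v)"
  by (auto simp: pure_tensor_def fun_scale_def form_simps power3_eq_cube)

lemma cube_root: "\<exists>z::complex. z ^ 3 = of_real x"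
  by (rule exI[of _ "of_real (root 3 x)"]) (simp add: of_real_power[symmetric] odd_real_root_pow)

text \<open>Sums carry no coefficients: over the complex numbers a scalar is absorbed into a cube by
  a cube root.\<close>

inductive cube_sum :: "('v \<times> 'v \<times> 'v \<Rightarrow> complex) \<Rightarrow> bool" where
  zero: "cube_sum 0"
| add: "cube_sum T \<Longrightarrow> cube_sum (T + cube v)"

lemma cube_sum_W: "cube_sum T \<Longrightarrow> T \<in> W"
  by (induction rule: cube_sum.induct) (auto intro: W_add W_zero W_cube)

text \<open>The symmetrization of \<open>pure_tensor form a b c\<close>.\<close>

definition symp :: "'v \<Rightarrow> 'v \<Rightarrow> 'v \<Rightarrow> 'v \<times> 'v \<times> 'v \<Rightarrow> complex" where
  "symp a b c = (\<lambda>(x, y, z).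
     (form a x * form b y * form c z + form a y * form b x * form c z +
      form a x * form b z * form c y + form a z * form b x * form c y +
      form a y * form b z * form c x + form a z * form b y * form c x) / 6)"

text \<open>The polarization identity 24abc = (a+b+c)^3 + (a-b-c)^3 + (b-a-c)^3 + (c-a-b)^3; the
  scalar \<open>k\<close> absorbs the 24.\<close>

lemma symp_cubes: "\<exists>p q r s. symp a b c = cube p + cube q + cube r + cube s"
proof -
  obtain k :: complex where "k ^ 3 = of_real (1 / 24)" using cube_root by blast
  then have k: "k * (k * k) = 1 / 24" by (simp add: power3_eq_cube mult.assoc)
  have cube: "cube (scale k v) = (\<lambda>(x, y, z). form v x * form v y * form v z / 24)" for v
  proof -
    have "cube (scale k v) (x, y, z) = k * (k * k) * (form v x * form v y * form v z)" for x y z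
      by (simp add: pure_tensor_def form_simps)
    then show ?thesis by (auto simp: k)
  qed
  have "symp a b c = cube (scale k (a + b + c)) + cube (scale k (a - b - c)) +
      cube (scale k (b - a - c)) + cube (scale k (c - a - b))"
    unfolding cube
    by (auto simp: symp_def fun_eq_iff fun_apply form_simps form_diff field_simps)
  then show ?thesis by blast
qed

lemma symp_W: "symp a b c \<in> W"
  using symp_cubes[of a b c] by (auto intro!: W_add W_cube)

text \<open>A symmetric tensor is its own average over the six permutations, so each pure tensor in
  a presentation may be replaced by its symmetrization.\<close>

lemma cube_sum_spans:
  assumes T: "T \<in> W"
  shows "cube_sum T"
proof -
  obtain k :: nat and a b c where eq: "T = (\<Sum>i<k. pure_tensor form (a i) (b i) (c i))"
    using W_tensor3[OF T] by (auto simp: tensor3_def)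
  have s: "T (y, x, z) = T (x, y, z)" "T (x, z, y) = T (x, y, z)" for x y z
    using T by (auto simp: sym_tensor3_def)
  have "T (x, y, z) = (\<Sum>i<k. symp (a i) (b i) (c i)) (x, y, z)" for x y z
  proof -
    have "T (x, y, z) = (T (x, y, z) + T (y, x, z) + T (x, z, y) + T (z, x, y) +
        T (y, z, x) + T (z, y, x)) / 6"
      using s(1)[of x y z] s(2)[of x y z] s(1)[of x z y] s(2)[of y x z] s(1)[of y z x] by simp
    also have "\<dots> = (\<Sum>i<k. symp (a i) (b i) (c i)) (x, y, z)"
      by (simp add: eq sum_fun_apply pure_tensor_def symp_def sum_divide_distrib[symmetric]
          sum.distrib)
    finally show ?thesis .
  qed
  then have "T = (\<Sum>i<k. symp (a i) (b i) (c i))" by auto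
  moreover have "cube_sum (\<Sum>i<k. symp (a i) (b i) (c i))"
  proof (induction k)
    case (Suc k)
    obtain p q r s where "symp (a k) (b k) (c k) = cube p + cube q + cube r + cube s"
      using symp_cubes by blast
    moreover have "cube_sum ((\<Sum>i<k. symp (a i) (b i) (c i)) + cube p + cube q + cube r + cube s)"
      by (intro cube_sum.add Suc.IH)
    ultimately show ?case by (simp only: sum.lessThan_Suc add.assoc)
  qed (simp add: cube_sum.zero)
  ultimately show ?thesis by simp
qed

section \<open>Quadratic functions and their polarization\<close>

lemma fun_scale_2: "fun_scale 2 T = T + T"
  by (auto simp: fun_scale_def fun_apply)

definition polar :: "(('v \<times> 'v \<times> 'v \<Rightarrow> complex) \<Rightarrow> complex) \<Rightarrow> 'v \<Rightarrow> 'v \<Rightarrow> complex" where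
  "polar q v w = q (cube v + cube w) - q (cube v) - q (cube w)"

text \<open>Being quadratic, expressed by functional equations: a vanishing third difference leaves
  a quadratic plus an additive part, and scaling by 2 excludes the latter. These conditions are
  linear in \<open>q\<close>, hence pass to spans.\<close>

definition quadratics :: "(('v \<times> 'v \<times> 'v \<Rightarrow> complex) \<Rightarrow> complex) set" where
  "quadratics = {q. q 0 = 0 \<and> (\<forall>T\<in>W. q (fun_scale 2 T) = 4 * q T) \<and>
     (\<forall>R\<in>W. \<forall>S\<in>W. \<forall>T\<in>W. q (R + S + T) = q (R + S) + q (R + T) + q (S + T) - q R - q S - q T)}"

lemma subspace_quadratics: "fun_space.subspace quadratics"
proof (rule fun_space.subspaceI)
  fix x y
  assume "x \<in> quadratics" "y \<in> quadratics"
  then show "x + y \<in> quadratics"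
    unfolding quadratics_def by (auto simp: fun_apply)
next
  fix c x
  assume "x \<in> quadratics"
  then show "fun_scale c x \<in> quadratics"
    unfolding quadratics_def
    by (auto simp: fun_scale_def[of c x] ring_distribs)
qed (simp add: quadratics_def fun_apply)

text \<open>Induction on the number of cubes. Additivity against one further cube is carried along,
  because the third difference then reduces everything to pairs of cubes.\<close>

lemma quadratic_vanishes:
  assumes q: "q \<in> quadratics" and p: "\<And>v w. polar q v w = 0" and T: "T \<in> W"
  shows "q T = 0"
proof -
  have "q T = 0 \<and> (\<forall>w. q (T + cube w) = q T + q (cube w))"
    using cube_sum_spans[OF T]
  proof (induction rule: cube_sum.induct)
    case zero
    then show ?case using q by (simp add: quadratics_def)
  next
    case (add T v)
    \<comment> \<open>Homogeneity gives the factor 4, whereas \<open>polar q v v = 0\<close> gives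
      the factor 2.\<close>
    have "q (fun_scale 2 (cube v)) = 4 * q (cube v)" using q W_cube by (simp add: quadratics_def)
    then have v: "q (cube v) = 0" using p[of v v] unfolding polar_def fun_scale_2 by simp
    have "q (T + cube v + cube w) = q (T + cube v) + q (T + cube w) + q (cube v + cube w)
        - q T - q (cube v) - q (cube w)" for w
      using q W_cube cube_sum_W[OF add.hyps] by (simp add: quadratics_def)
    then show ?case using add.IH v p[of v] by (simp add: polar_def)
  qed
  then show ?thesis by blast
qed

text \<open>A functional on \<open>W\<close> need not behave linearly on pure tensors, which may lie
  outside \<open>W\<close>; \<open>symp\<close> is trilinear with values in
  \<open>W\<close>.\<close>

lemma functional_symp:
  assumes l: "l \<in> linear_functionals W"
  shows "Vector_Spaces.linear scale (*) (\<lambda>a. l (symp a b c))"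
    "Vector_Spaces.linear scale (*) (\<lambda>b. l (symp a b c))"
    "Vector_Spaces.linear scale (*) (\<lambda>c. l (symp a b c))"
proof -
  have add: "l (S + T) = l S + l T" if "S \<in> W" "T \<in> W" for S T
    using l that by (auto simp: linear_functionals_def)
  have mul: "l (fun_scale k T) = k * l T" if "T \<in> W" for k T
    using l that by (auto simp: linear_functionals_def)
  have "symp (a + a') b c = symp a b c + symp a' b c" "symp b (a + a') c = symp b a c + symp b a' c"
    "symp b c (a + a') = symp b c a + symp b c a'" "symp (scale k a) b c = fun_scale k (symp a b c)"
    "symp b (scale k a) c = fun_scale k (symp b a c)" "symp b c (scale k a) = fun_scale k (symp b c a)"
    for a a' b c k
    by (auto simp: symp_def fun_scale_def fun_eq_iff fun_apply form_simps field_simps)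
  then show "Vector_Spaces.linear scale (*) (\<lambda>a. l (symp a b c))"
    "Vector_Spaces.linear scale (*) (\<lambda>b. l (symp a b c))"
    "Vector_Spaces.linear scale (*) (\<lambda>c. l (symp a b c))"
    by (simp_all add: linear_mult_iff vector_space_axioms add mul symp_W)
qed

lemma bihom_functional_cube:
  assumes l: "l \<in> linear_functionals W"
  shows "bihom (\<lambda>x. x) 3 0 (\<lambda>v w. l (cube v))"
proof -
  obtain B :: "'v set" and u where B: "finite B"
    "\<And>g x. Vector_Spaces.linear scale (*) g \<Longrightarrow> g x = (\<Sum>b\<in>B. form (u b) x * g b)"
    using dual_basis by blast
  have "l (cube v) = (\<Sum>a\<in>B. form (u a) v * (\<Sum>b\<in>B. form (u b) v *
      (\<Sum>c\<in>B. form (u c) v * l (symp a b c))))" for v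
  proof -
    have 3: "l (symp a b v) = (\<Sum>c\<in>B. form (u c) v * l (symp a b c))" for a b
      by (rule B(2)[OF functional_symp(3)[OF l]])
    have 2: "l (symp a v v) = (\<Sum>b\<in>B. form (u b) v * l (symp a b v))" for a
      by (rule B(2)[OF functional_symp(2)[OF l]])
    have "cube v = symp v v v" by (auto simp: symp_def pure_tensor_def)
    then have "l (cube v) = l (symp v v v)" by simp
    also have "\<dots> = (\<Sum>a\<in>B. form (u a) v * l (symp a v v))"
      by (rule B(2)[OF functional_symp(1)[OF l]])
    also have "\<dots> = (\<Sum>a\<in>B. form (u a) v * (\<Sum>b\<in>B. form (u b) v * l (symp a b v)))"
      by (simp only: 2)
    also have "\<dots> = (\<Sum>a\<in>B. form (u a) v * (\<Sum>b\<in>B. form (u b) v *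
      (\<Sum>c\<in>B. form (u c) v * l (symp a b c))))"
      by (simp only: 3)
    finally show ?thesis .
  qed
  moreover have "bihom (\<lambda>x. x) (Suc (Suc (Suc 0))) 0 (\<lambda>v w. (\<Sum>a\<in>B. form (u a) v *
      (\<Sum>b\<in>B. form (u b) v * (\<Sum>c\<in>B. form (u c) v * l (symp a b c)))))"
    by (intro bihom_sum bihom.left bihom.const)
  ultimately show ?thesis by (simp add: numeral_3_eq_3)
qed

lemma homogeneous_quadratic:
  assumes "q \<in> homogeneous_polys W 2"
  shows "q \<in> quadratics" "bihom (\<lambda>x. x) 3 3 (polar q)"
proof -
  have prod: "(\<lambda>T. l T * m T) \<in> quadratics" "bihom (\<lambda>x. x) 3 3 (polar (\<lambda>T. l T * m T))"
    if l: "l \<in> linear_functionals W" and m: "m \<in> linear_functionals W" for l m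
  proof -
    have add: "k (S + T) = k S + k T" if "k \<in> {l, m}" "S \<in> W" "T \<in> W" for k S T
      using l m that by (auto simp: linear_functionals_def)
    have two: "k (fun_scale 2 T) = 2 * k T" if "k \<in> {l, m}" "T \<in> W" for k T
      using l m that by (auto simp: linear_functionals_def)
    have "k 0 = 0" if "k \<in> {l, m}" for k using add[OF that W_zero W_zero] by simp
    then show "(\<lambda>T. l T * m T) \<in> quadratics"
      by (auto simp: quadratics_def add two W_add algebra_simps)
    \<comment> \<open>Only the cross terms survive, each a cubic in \<open>v\<close> times a cubic
      in \<open>w\<close>.\<close>
    have "polar (\<lambda>T. l T * m T) = (\<lambda>v w. l (cube v) * m (cube w) + m (cube v) * l (cube w))"
      by (auto simp: polar_def fun_eq_iff add W_cube algebra_simps)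
    then show "bihom (\<lambda>x. x) 3 3 (polar (\<lambda>T. l T * m T))"
      using bihom.add[OF
        bihom_mult[OF bihom_functional_cube[OF l] bihom_swap[OF bihom_functional_cube[OF m]]]
        bihom_mult[OF bihom_functional_cube[OF m] bihom_swap[OF bihom_functional_cube[OF l]]]]
      by simp
  qed
  have "q \<in> quadratics \<and> bihom (\<lambda>x. x) 3 3 (polar q)"
    using assms unfolding homogeneous_polys_def
  proof (induction rule: fun_space.span_induct_alt)
    case base
    have "polar 0 = (\<lambda>v w. 0)" by (auto simp: polar_def fun_eq_iff fun_apply)
    then show ?case using fun_space.subspace_0[OF subspace_quadratics] by (simp add: bihom.zero)
  next
    case (step c x y)
    then obtain l where l: "x = (\<lambda>T. \<Prod>i<2. l i T)" "\<forall>i<(2::nat). l i \<in> linear_functionals W"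
      by blast
    then have x: "x = (\<lambda>T. l 0 T * l 1 T)" by (simp add: numeral_2_eq_2)
    have "fun_scale c x + y \<in> quadratics"
      using step.IH prod(1)[of "l 0" "l 1"] l(2) x subspace_quadratics
      by (auto intro!: fun_space.subspace_add fun_space.subspace_scale)
    moreover have "polar (fun_scale c x + y) = (\<lambda>v w. c * polar x v w + polar y v w)"
      by (auto simp: polar_def fun_apply fun_scale_def fun_eq_iff algebra_simps)
    ultimately show ?case
      using step.IH prod(2)[of "l 0" "l 1"] l(2) x by (simp add: bihom.add bihom_cmult)
  qed
  then show "q \<in> quadratics" "bihom (\<lambda>x. x) 3 3 (polar q)" by auto
qed


section \<open>Robeva's equations\<close>

lemma mu_add:
  assumes "S \<in> tensor3 form" "T \<in> tensor3 form"
  shows "mu scale form (S + T) x y = mu scale form S x y + mu scale form T x y"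
  by (rule form_eqI) (simp add: form_mu assms tensor3_add form_simps fun_apply)

lemma mu_zero: "mu scale form 0 x y = 0"
  by (rule form_eqI) (simp add: form_mu tensor3_zero form_simps fun_apply)

lemma mu_cube: "mu scale form (cube v) x y = scale (form v x * form v y) v"
  by (rule form_eqI) (simp only: form_mu W_tensor3[OF W_cube] form_simps, simp add: pure_tensor_def)

lemma mu_double:
  assumes "T \<in> tensor3 form"
  shows "mu scale form (fun_scale 2 T) x y = mu scale form T x y + mu scale form T x y"
  unfolding fun_scale_2 by (rule mu_add[OF assms assms])

lemma W_double: "T \<in> W \<Longrightarrow> fun_scale 2 T \<in> W"
  unfolding fun_scale_2 by (rule W_add)

lemma robeva_quadratic: "robeva scale form x y z w \<in> quadratics"
  by (auto simp: quadratics_def mu_double W_double robeva_alt W_zero W_add mu_zero mu_add W_tensor3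
      tensor3_add form_simps)

text \<open>One symmetrized product, that is, half of a minor from the overview; a difference of two
  of these is the full minor.\<close>

definition minor :: "'v \<Rightarrow> 'v \<Rightarrow> 'v \<Rightarrow> 'v \<Rightarrow> 'v \<Rightarrow> 'v \<Rightarrow> complex" where
  "minor a b c d v w = form a v * form b v * form c w * form d w +
     form c v * form d v * form a w * form b w"

text \<open>\<open>mu\<close> of a cube is a multiple of the vector itself, so each cross term
  between the cubes of \<open>v\<close> and \<open>u\<close> contains
  \<open>form v u\<close>.\<close>

lemma polar_robeva:
  "polar (robeva scale form x y z w) v u = form v u * (minor y z x w v u - minor x y z w v u)"
  by (simp add: polar_def robeva_alt W_cube W_add mu_add mu_cube W_tensor3 form_simps minor_def
      form_sym[of u v] form_sym[of x v] form_sym[of y v] form_sym[of z v] form_sym[of w v]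
      form_sym[of x u] form_sym[of y u] form_sym[of z u] form_sym[of w u] algebra_simps)

text \<open>Up to Robeva's equations, \<open>minor a b c d\<close> may be replaced by its average over the three
  splittings of \<open>a, b, c, d\<close> into pairs. That average is a multiple of the \<open>t\<^sup>2\<close>-coefficient of
  the quartic form at \<open>v + t w\<close>, which is here extracted by the values at the fourth
  roots of unity \<open>t\<close>.\<close>

lemma polar_robeva_span:
  assumes "bihom (\<lambda>x. x) 2 2 R"
  shows "\<exists>r \<in> fun_space.span (robeva_equations scale form). \<forall>v w.
    polar r v w = form v w * (R v w + R w v -
      (R (v + w) (v + w) + R (v - w) (v - w) -
       R (v + scale \<i> w) (v + scale \<i> w) - R (v - scale \<i> w) (v - scale \<i> w)) / 12)"
proof -
  let ?E = "fun_space.span (robeva_equations scale form)"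
  \<comment> \<open>For a monomial the signed sum over the four roots is 4 times the coefficient,
    which is the sum of three values of \<open>minor\<close>; dividing by 12 = 4 * 3 gives their
    average.\<close>
  define D where "D R v w = R v w + R w v -
      (R (v + w) (v + w) + R (v - w) (v - w) -
       R (v + scale \<i> w) (v + scale \<i> w) - R (v - scale \<i> w) (v - scale \<i> w)) / 12"
    for R :: "'v \<Rightarrow> 'v \<Rightarrow> complex" and v w
  obtain L where L: "\<forall>(c, as, bs)\<in>set L. length as = 2 \<and> length bs = 2"
    and R: "R = (\<lambda>v w. \<Sum>(c, as, bs)\<leftarrow>L. c * (\<Prod>a\<leftarrow>as. form a v) * (\<Prod>b\<leftarrow>bs. form b w))"
    using bihom_list[OF assms] by (auto simp: fun_eq_iff)
  have rob: "robeva scale form x y z w \<in> ?E" for x y z w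
    by (rule fun_space.span_base) (auto simp: robeva_equations_def)
  have "\<exists>r\<in>?E. \<forall>v w. polar r v w = form v w *
      D (\<lambda>v w. \<Sum>(c, as, bs)\<leftarrow>L. c * (\<Prod>a\<leftarrow>as. form a v) * (\<Prod>b\<leftarrow>bs. form b w)) v w"
    using L
  proof (induction L)
    case Nil
    show ?case by (rule bexI[of _ 0]) (auto simp: polar_def D_def fun_apply fun_space.span_zero)
  next
    case (Cons x L)
    obtain k as bs where x: "x = (k, as, bs)" by (cases x) auto
    with Cons.prems have "length as = 2" "length bs = 2" by auto
    then obtain a b c d where "as = [a, b]" "bs = [c, d]"
      by (auto simp: numeral_2_eq_2 length_Suc_conv)
    note x = x this
    obtain r where r: "r \<in> ?E" "\<And>v w. polar r v w = form v w *
      D (\<lambda>v w. \<Sum>(c, as, bs)\<leftarrow>L. c * (\<Prod>a\<leftarrow>as. form a v) * (\<Prod>b\<leftarrow>bs. form b w)) v w"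
      using Cons by auto
    \<comment> \<open>Comparing the splitting ab|cd with ca|bd and with cb|ad gives twice the first
      minus the other two, which is 3 times the first minus the average; hence the factor
      \<open>k / 3\<close>.\<close>
    let ?s = "robeva scale form c a b d + robeva scale form c b a d"
    have s: "fun_scale (k / 3) ?s + r \<in> ?E"
      by (intro fun_space.span_add fun_space.span_scale rob r)
    have pol: "polar (fun_scale (k / 3) ?s + r) v w = k / 3 * (polar (robeva scale form c a b d) v w +
        polar (robeva scale form c b a d) v w) + polar r v w" for v w
      by (simp add: polar_def fun_apply fun_scale_def algebra_simps)
    have D: "D (\<lambda>v w. \<Sum>(c, as, bs)\<leftarrow>x # L. c * (\<Prod>a\<leftarrow>as. form a v) * (\<Prod>b\<leftarrow>bs. form b w)) v w =
      k / 3 * (minor a b c d v w - minor c a b d v w + (minor b a c d v w - minor c b a d v w)) +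
      D (\<lambda>v w. \<Sum>(c, as, bs)\<leftarrow>L. c * (\<Prod>a\<leftarrow>as. form a v) * (\<Prod>b\<leftarrow>bs. form b w)) v w" for v w
    proof -
      have add: "D (\<lambda>v w. f v w + g v w) v w = D f v w + D g v w" for f g
        by (simp add: D_def field_simps)
      have ii: "\<i> * (\<i> * z) = - z" for z by (simp add: mult.assoc[symmetric])
      have "D (\<lambda>v w. k * (form a v * form b v) * (form c w * form d w)) v w = k / 3 *
        (minor a b c d v w - minor c a b d v w + (minor b a c d v w - minor c b a d v w))"
        by (simp add: D_def minor_def form_simps form_diff field_simps ii)
      then show ?thesis by (simp add: x add)
    qed
    show ?case
    proof (intro bexI[OF _ s] allI)
      fix v w
      show "polar (fun_scale (k / 3) ?s + r) v w = form v w *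
        D (\<lambda>v w. \<Sum>(c, as, bs)\<leftarrow>x # L. c * (\<Prod>a\<leftarrow>as. form a v) * (\<Prod>b\<leftarrow>bs. form b w)) v w"
        unfolding pol D polar_robeva r(2) by (simp add: field_simps)
    qed
  qed
  then show ?thesis unfolding R D_def .
qed

section \<open>Strongly odeco tensors with at most two summands, and the conclusion\<close>

lemma strongly_odeco_vanish:
  assumes "\<And>T. T \<in> odeco_variety form \<Longrightarrow> q T = 0" and "strongly_odeco form T"
  shows "q T = 0"
  using assms strongly_odeco_sym by (auto simp: odeco_variety_def zariski_closure_def)

lemma strongly_odeco_zero: "strongly_odeco form 0"
  unfolding strongly_odeco_def by (intro exI[of _ 0]) auto

lemma strongly_odeco_cube:
  assumes "form v v \<noteq> 0"
  shows "strongly_odeco form (cube v)"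
  unfolding strongly_odeco_def
  by (rule exI[of _ 1], rule exI[of _ "\<lambda>_. v"]) (use assms in \<open>auto simp: form_simps\<close>)

lemma strongly_odeco_add:
  assumes "form v v \<noteq> 0" "form w w \<noteq> 0" "form v w = 0"
  shows "strongly_odeco form (cube v + cube w)"
  unfolding strongly_odeco_def
  by (rule exI[of _ 2], rule exI[of _ "\<lambda>i. if i = 0 then v else w"])
    (use assms form_sym[of w v] in \<open>auto simp: form_simps numeral_2_eq_2\<close>)

lemma strongly_odeco_double:
  assumes "form v v \<noteq> 0"
  shows "strongly_odeco form (cube v + cube v)"
proof -
  obtain c :: complex where c: "c ^ 3 = of_real 2" using cube_root by blast
  then have "cube (scale c v) = cube v + cube v"
    by (auto simp: cube_scale fun_scale_def)
  moreover have "c \<noteq> 0" using c by auto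
  ultimately show ?thesis
    using strongly_odeco_cube[of "scale c v"] assms by (simp add: form_simps)
qed

lemma quadratic_in_span_robeva:
  assumes q: "q \<in> homogeneous_polys W 2"
    and van: "\<And>T. T \<in> odeco_variety form \<Longrightarrow> q T = 0"
  shows "\<exists>r \<in> fun_space.span (robeva_equations scale form). \<forall>T \<in> W. q T = r T"
proof -
  have odeco: "q T = 0" if "strongly_odeco form T" for T
    using strongly_odeco_vanish[OF van that] .
  have "\<exists>R. bihom (\<lambda>x. x) 2 2 R \<and> (\<forall>v w. polar q v w = form v w * R v w) \<and> (\<forall>v. R v v = 0)"
  proof (cases "\<exists>e. form e e \<noteq> 0")
    case True
    then obtain e0 where e0: "form e0 e0 \<noteq> 0" by blast
    define e where "e = scale (1 / csqrt (form e0 e0)) e0"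
    have e: "form e e = 1"
      using e0 by (simp add: e_def form_simps field_simps power2_eq_square[symmetric])
    have "polar q v w = 0" if "form v w = 0" "form v v \<noteq> 0" "form w w \<noteq> 0" for v w
      using that
      by (simp add: polar_def odeco[OF strongly_odeco_cube] odeco[OF strongly_odeco_add])
    from divisible_by_form[OF e _ homogeneous_quadratic(2)[OF q] this]
    obtain R where R: "bihom (\<lambda>x. x) 2 2 R" "\<And>v w. polar q v w = form v w * R v w" by auto
    have "R v v * form v v = 0" for v
    proof (cases "form v v = 0")
      case False
      then have "polar q v v = 0"
        unfolding polar_def odeco[OF strongly_odeco_cube[OF False]]
          odeco[OF strongly_odeco_double[OF False]] by simp
      then show ?thesis using R(2)[of v v] by auto
    qed simp
    \<comment> \<open>The segment from \<open>(v, v)\<close> to \<open>(e, e)\<close> stays in the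
      diagonal, so the factor \<open>form v v\<close> can be cancelled there.\<close>
    then have "R v v = 0" for v
      using bihom_mult_eq_0_on_line[of "\<lambda>x. x", OF refl R(1) bihom_form, of e e v v] e by simp
    with R show ?thesis by blast
  next
    \<comment> \<open>A symmetric form without non-isotropic vectors is zero, so nondegeneracy
      leaves only \<open>V = 0\<close>.\<close>
    case False
    have "form x y = 0" for x y
      using False[simplified, rule_format, of "x + y"] False form_sym[of x y]
      by (simp add: form_simps)
    then have "v = 0" for v :: 'v using form_nondegenerate[of v] by simp
    moreover have "cube 0 = 0" by (auto simp: pure_tensor_def form_simps fun_apply)
    ultimately have "cube v = 0" for v by metis
    then have "polar q v w = 0" for v w
      using odeco[OF strongly_odeco_zero] by (simp add: polar_def)
    then show ?thesis by (intro exI[of _ "\<lambda>v w. 0"]) (simp add: bihom.zero)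
  qed
  then obtain R where R: "bihom (\<lambda>x. x) 2 2 R" "\<And>v w. polar q v w = form v w * R v w"
    "\<And>v. R v v = 0" by blast
  \<comment> \<open>Since \<open>R\<close> vanishes on the diagonal, the averaged quartic term drops
    out.\<close>
  obtain r where r: "r \<in> fun_space.span (robeva_equations scale form)"
    "\<And>v w. polar r v w = form v w * (R v w + R w v)"
    using polar_robeva_span[OF R(1)] by (auto simp: R(3))
  \<comment> \<open>The polarization of \<open>r\<close> is
    \<open>polar q v w + polar q w v\<close>, twice that of \<open>q\<close> by symmetry.\<close>
  let ?r = "fun_scale (1 / 2) r"
  have rE: "?r \<in> fun_space.span (robeva_equations scale form)"
    using r(1) by (rule fun_space.span_scale)
  have "robeva_equations scale form \<subseteq> quadratics"
    using robeva_quadratic by (auto simp: robeva_equations_def)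
  then have "q - ?r \<in> quadratics"
    using fun_space.span_minimal[OF _ subspace_quadratics] rE homogeneous_quadratic(1)[OF q]
    by (intro fun_space.subspace_diff[OF subspace_quadratics]) auto
  moreover have "polar (q - ?r) v w = 0" for v w
  proof -
    have "polar (q - ?r) v w = polar q v w - polar r v w / 2"
      by (simp add: polar_def fun_scale_def field_simps)
    moreover have "polar q v w = polar q w v" by (simp add: polar_def add.commute)
    moreover have "polar r v w = polar q v w + polar q w v"
      by (simp add: r(2) R(2) form_sym[of w v] ring_distribs)
    ultimately show ?thesis by simp
  qed
  ultimately have "q T = ?r T" if "T \<in> W" for T
    using quadratic_vanishes[of "q - ?r" T] that by simp
  with rE show ?thesis by blast
qed

end

theorem proposition2p8:
  fixes scale :: "complex \<Rightarrow> 'v::ab_group_add \<Rightarrow> 'v"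
    and form :: "'v \<Rightarrow> 'v \<Rightarrow> complex"
    and q :: "('v \<times> 'v \<times> 'v \<Rightarrow> complex) \<Rightarrow> complex"
  assumes "quadratic_space scale form"
    and "q \<in> homogeneous_polys (sym_tensor3 form) 2"
    and "\<And>T. T \<in> odeco_variety form \<Longrightarrow> q T = 0"
  shows "\<exists>r \<in> fun_space.span (robeva_equations scale form). \<forall>T \<in> sym_tensor3 form. q T = r T"
  using quadratic_space.quadratic_in_span_robeva[OF assms] .

end
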